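(* Let $E$ be a Dedekind complete Riesz space with a strictly positive conditional expectation operator $T$ on $E$ and a weak order unit $e=Te$. Let $(P_n)_{n\ge1}$ be a sequence of band projections on $E$ such that $T(P_ne)\to0$ in order as $n\to\infty$, and such that, for some integer $m\ge1$, the series $$\sum_{n=1}^\infty T\Bigg(P_{n+m}\prod_{j=n}^{n+m-1}(I-P_j)\,e\Bigg)$$ is order convergent in $E$. Then $\limsup_{n\to\infty}P_n=0$.
   Context: A conditional expectation operator on a Dedekind complete Riesz space $E$ with weak order unit is a positive order continuous linear projection $T:E\to E$ (so $T^2=T$) whose range $R(T)$ is a Dedekind complete Riesz subspace of $E$, and such that $T(u)$ is a weak order unit of $E$ for each weak order unit $u$ of $E$. $T$ is strictly positive if $f\ge0$ and $Tf=0$ imply $f=0$. $I$ is the identity operator on $E$; products of band projections are compositions. An order bounded sequence $(f_n)$ in $E$ converges in order iff $\sup_{k}\inf_{n\ge k}f_n=\inf_k\sup_{n\ge k}f_n$, and the common value is its order limit. A series is order convergent if its sequence of partial sums is order convergent in $E$. Band projections are ordered as operators ($P\le Q$ iff $Pf\le Qf$ for all $f\ge0$); they form a complete Boolean algebra because $E$ is Dedekind complete, and $\limsup_{n\to\infty}P_n=\bigwedge_{k\ge1}\bigvee_{n\ge k}P_n$. *)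

theory Defs
  imports Complex_Main
begin

text \<open>
  A Dedekind complete Riesz space is a type of sort
  \<open>{ordered_real_vector, conditionally_complete_lattice}\<close>: an ordered real vector space that is
  a lattice in which every nonempty subset that is bounded above (below) has a supremum (infimum).
\<close>

subsection \<open>Bands, weak order units, band projections\<close>

definition riesz_abs :: "'a::{ordered_real_vector, conditionally_complete_lattice} \<Rightarrow> 'a" where
  "riesz_abs x = sup x (- x)"

definition is_ideal :: "'a::{ordered_real_vector, conditionally_complete_lattice} set \<Rightarrow> bool" where
  "is_ideal B \<longleftrightarrow> subspace B \<and> (\<forall>x y. y \<in> B \<and> riesz_abs x \<le> riesz_abs y \<longrightarrow> x \<in> B)"

definition is_band :: "'a::{ordered_real_vector, conditionally_complete_lattice} set \<Rightarrow> bool" where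
  "is_band B \<longleftrightarrow> is_ideal B \<and>
     (\<forall>A. A \<subseteq> B \<and> A \<noteq> {} \<and> bdd_above A \<longrightarrow> Sup A \<in> B)"

text \<open>
  The band generated by \<open>u\<close> is all of the space.  Positivity is not required to be strict, so that
  \<open>0\<close> is a weak order unit of the trivial space; in a nontrivial space it makes no difference.
\<close>

definition weak_order_unit ::
    "'a::{ordered_real_vector, conditionally_complete_lattice} \<Rightarrow> bool" where
  "weak_order_unit u \<longleftrightarrow> 0 \<le> u \<and> is_band hull {u} = UNIV"

definition disjoint_complement ::
    "'a::{ordered_real_vector, conditionally_complete_lattice} set \<Rightarrow> 'a set" where
  "disjoint_complement B = {x. \<forall>y\<in>B. inf (riesz_abs x) (riesz_abs y) = 0}"

text \<open>
  \<open>P\<close> is the projection onto a band \<open>B\<close> along its disjoint complement.  Linearity and idempotence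
  of \<open>P\<close> follow, the decomposition of each vector being unique.
\<close>

definition band_projection ::
    "('a::{ordered_real_vector, conditionally_complete_lattice} \<Rightarrow> 'a) \<Rightarrow> bool" where
  "band_projection P \<longleftrightarrow>
     (\<exists>B. is_band B \<and> (\<forall>f. P f \<in> B \<and> f - P f \<in> disjoint_complement B))"

subsection \<open>Conditional expectation operators\<close>

definition positive_op ::
    "('a::{ordered_real_vector, conditionally_complete_lattice} \<Rightarrow> 'a) \<Rightarrow> bool" where
  "positive_op T \<longleftrightarrow> (\<forall>f\<ge>0. 0 \<le> T f)"

text \<open>
  Order continuity of a positive operator: it maps every set directed downwards to \<open>0\<close> to a set
  with infimum \<open>0\<close>.
\<close>

definition order_continuous ::
    "('a::{ordered_real_vector, conditionally_complete_lattice} \<Rightarrow> 'a) \<Rightarrow> bool" where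
  "order_continuous T \<longleftrightarrow>
     (\<forall>D. D \<noteq> {} \<and> (\<forall>x\<in>D. \<forall>y\<in>D. \<exists>z\<in>D. z \<le> x \<and> z \<le> y) \<and> bdd_below D \<and> Inf D = 0
        \<longrightarrow> bdd_below (T ` D) \<and> Inf (T ` D) = 0)"

definition riesz_subspace ::
    "'a::{ordered_real_vector, conditionally_complete_lattice} set \<Rightarrow> bool" where
  "riesz_subspace R \<longleftrightarrow> subspace R \<and> (\<forall>x\<in>R. \<forall>y\<in>R. sup x y \<in> R \<and> inf x y \<in> R)"

text \<open>Bounds and suprema are taken in \<open>R\<close> itself, as an ordered set in its own right.\<close>

definition dedekind_complete_set :: "'a::order set \<Rightarrow> bool" where
  "dedekind_complete_set R \<longleftrightarrow>
     (\<forall>A. A \<subseteq> R \<and> A \<noteq> {} \<and> (\<exists>b\<in>R. \<forall>a\<in>A. a \<le> b) \<longrightarrow>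
        (\<exists>s\<in>R. (\<forall>a\<in>A. a \<le> s) \<and> (\<forall>b\<in>R. (\<forall>a\<in>A. a \<le> b) \<longrightarrow> s \<le> b)))"

definition conditional_expectation ::
    "('a::{ordered_real_vector, conditionally_complete_lattice} \<Rightarrow> 'a) \<Rightarrow> bool" where
  "conditional_expectation T \<longleftrightarrow>
     linear T \<and> positive_op T \<and> order_continuous T \<and> T \<circ> T = T \<and>
     riesz_subspace (range T) \<and> dedekind_complete_set (range T) \<and>
     (\<forall>u. weak_order_unit u \<longrightarrow> weak_order_unit (T u))"

definition strictly_positive ::
    "('a::{ordered_real_vector, conditionally_complete_lattice} \<Rightarrow> 'a) \<Rightarrow> bool" where
  "strictly_positive T \<longleftrightarrow> (\<forall>f\<ge>0. T f = 0 \<longrightarrow> f = 0)"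

subsection \<open>Order convergence\<close>

text \<open>Sequences are indexed by \<open>n \<ge> 1\<close>; the value at \<open>0\<close> is ignored throughout.\<close>

definition order_converges_to ::
    "(nat \<Rightarrow> 'a::conditionally_complete_lattice) \<Rightarrow> 'a \<Rightarrow> bool" where
  "order_converges_to f l \<longleftrightarrow>
     bdd_below (f ` {1..}) \<and> bdd_above (f ` {1..}) \<and>
     (SUP k\<in>{1..}. INF n\<in>{k..}. f n) = l \<and> (INF k\<in>{1..}. SUP n\<in>{k..}. f n) = l"

definition series_order_convergent ::
    "(nat \<Rightarrow> 'a::{ordered_real_vector, conditionally_complete_lattice}) \<Rightarrow> bool" where
  "series_order_convergent a \<longleftrightarrow> (\<exists>s. order_converges_to (\<lambda>N. \<Sum>n=1..N. a n) s)"

subsection \<open>The Boolean algebra of band projections\<close>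

text \<open>This is not the pointwise order \<open>\<le>\<close> on functions: only positive arguments are compared.\<close>

definition op_le ::
    "('a::{ordered_real_vector, conditionally_complete_lattice} \<Rightarrow> 'a) \<Rightarrow> ('a \<Rightarrow> 'a) \<Rightarrow> bool" where
  "op_le P Q \<longleftrightarrow> (\<forall>f\<ge>0. P f \<le> Q f)"

definition is_band_projection_Sup ::
    "('a::{ordered_real_vector, conditionally_complete_lattice} \<Rightarrow> 'a) set \<Rightarrow> ('a \<Rightarrow> 'a) \<Rightarrow> bool"
  where
  "is_band_projection_Sup S Q \<longleftrightarrow> band_projection Q \<and> (\<forall>P\<in>S. op_le P Q) \<and>
     (\<forall>R. band_projection R \<and> (\<forall>P\<in>S. op_le P R) \<longrightarrow> op_le Q R)"

definition is_band_projection_Inf ::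
    "('a::{ordered_real_vector, conditionally_complete_lattice} \<Rightarrow> 'a) set \<Rightarrow> ('a \<Rightarrow> 'a) \<Rightarrow> bool"
  where
  "is_band_projection_Inf S Q \<longleftrightarrow> band_projection Q \<and> (\<forall>P\<in>S. op_le Q P) \<and>
     (\<forall>R. band_projection R \<and> (\<forall>P\<in>S. op_le R P) \<longrightarrow> op_le R Q)"

text \<open>
  \<open>L\<close> is the infimum over \<open>k \<ge> 1\<close> of the suprema \<open>Q k\<close> of \<open>{P n | n \<ge> k}\<close>; the existence of these
  suprema and of the infimum is part of the assertion.
\<close>

definition is_band_projection_limsup ::
    "(nat \<Rightarrow> 'a::{ordered_real_vector, conditionally_complete_lattice} \<Rightarrow> 'a) \<Rightarrow> ('a \<Rightarrow> 'a) \<Rightarrow> bool"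
  where
  "is_band_projection_limsup P L \<longleftrightarrow>
     (\<exists>Q. (\<forall>k\<ge>1. is_band_projection_Sup (P ` {k..}) (Q k)) \<and>
          is_band_projection_Inf (Q ` {1..}) L)"

text \<open>
  \<open>(I - P\<^sub>n) \<circ> \<dots> \<circ> (I - P\<^bsub>n+m-1\<^esub>)\<close>; the order of the factors is immaterial, since band
  projections commute.
\<close>

definition complement_prod ::
    "(nat \<Rightarrow> 'a::{ordered_real_vector, conditionally_complete_lattice} \<Rightarrow> 'a) \<Rightarrow>
      nat \<Rightarrow> nat \<Rightarrow> 'a \<Rightarrow> 'a"
  where
  "complement_prod P n m = foldr (\<lambda>j f. f - P j f) [n..<n + m]"

end

theory Submission
  imports Defs
begin

text \<open>
  Write \<open>p\<^sub>n = P\<^sub>n e\<close> and \<open>q\<^sub>n\<close> for the part of \<open>e\<close> which \<open>P\<^bsub>n+m\<^esub>\<close> retains and each of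
  \<open>P\<^sub>n, \<dots>, P\<^bsub>n+m-1\<^esub>\<close> annihilates.  The argument is the Borel--Cantelli lemma, applied to the first
  occurrence of an event after a gap of length at least \<open>m\<close>.  Fix \<open>k \<ge> 1\<close> and let \<open>c\<^sub>i\<close> be the
  image of \<open>e\<close> under \<open>(I - P\<^sub>k) \<circ> \<dots> \<circ> (I - P\<^bsub>k+i-1\<^esub>)\<close>, the part of \<open>e\<close> on which
  none of the first \<open>i\<close> events from time \<open>k\<close> on has occurred.  Each step \<open>c\<^sub>i - c\<^bsub>i+1\<^esub>\<close> is
  the part of \<open>e\<close> where the first event from time \<open>k\<close> on is the one at time \<open>k + i\<close>; it is
  at most \<open>p\<^bsub>k+i\<^esub>\<close>, and for \<open>i \<ge> m\<close> also at most \<open>q\<^bsub>k+i-m\<^esub>\<close>, because it sees no event in the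
  preceding \<open>m\<close> steps.  Hence \<open>e - c\<^sub>i\<close> is at most \<open>p\<^sub>k + \<dots> + p\<^bsub>k+m-1\<^esub>\<close> plus a partial sum
  of \<open>q\<^sub>k, q\<^bsub>k+1\<^esub>, \<dots>\<close> (\<open>complement_prod_initial\<close> and \<open>complement_prod_later\<close>).

  The infimum of the \<open>c\<^sub>i\<close> is annihilated by every \<open>P\<^sub>n\<close> with \<open>n \<ge> k\<close>, hence by their supremum
  \<open>Q\<^sub>k\<close>, so \<open>Q\<^sub>k e\<close> lies below \<open>e\<close> minus that infimum (\<open>Sup_projection_bound\<close>).  Order continuity
  of \<open>T\<close> carries the estimate to \<open>T (Q\<^sub>k e)\<close>.  If a band projection \<open>R\<close> is below all \<open>Q\<^sub>k\<close>, then
  \<open>T (R e)\<close> is below \<open>m\<close> terms of an order null sequence plus a tail of an order convergent series,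
  for every \<open>k\<close>; so it is \<open>0\<close> (\<open>nonpos_of_order_null_bounds\<close>), \<open>R e = 0\<close> by strict
  positivity, and \<open>R = 0\<close> because the kernel of \<open>R\<close> is a band containing the weak order unit \<open>e\<close>.

  The suprema \<open>Q\<^sub>k\<close> have to be constructed.  Bands are projection bands in a Dedekind complete space
  (\<open>band_projection_onto\<close>), and the supremum of a family is the complement of the projection onto
  the common kernel.  Throughout, band projections are handled through their algebraic
  characterization as the linear idempotents \<open>P\<close> with \<open>0 \<le> P f \<le> f\<close> for all \<open>f \<ge> 0\<close>.
\<close>

section \<open>Absolute values and disjointness\<close>

lemma riesz_abs_ge:
  fixes x :: "'a::{ordered_real_vector, conditionally_complete_lattice}"
  shows "x \<le> riesz_abs x" "- x \<le> riesz_abs x"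
  by (simp_all add: riesz_abs_def)

lemma riesz_abs_le_iff:
  fixes x :: "'a::{ordered_real_vector, conditionally_complete_lattice}"
  shows "riesz_abs x \<le> y \<longleftrightarrow> x \<le> y \<and> - x \<le> y"
  by (simp add: riesz_abs_def)

lemma riesz_abs_nonneg:
  fixes x :: "'a::{ordered_real_vector, conditionally_complete_lattice}"
  shows "0 \<le> riesz_abs x"
proof -
  have "0 \<le> riesz_abs x + riesz_abs x"
    using add_mono[OF riesz_abs_ge[of x]] by simp
  then have "0 \<le> (1/2::real) *\<^sub>R (riesz_abs x + riesz_abs x)"
    by (intro scaleR_nonneg_nonneg) auto
  then show ?thesis
    by (simp flip: scaleR_2)
qed

lemma riesz_abs_of_nonneg:
  fixes x :: "'a::{ordered_real_vector, conditionally_complete_lattice}"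
  assumes "0 \<le> x"
  shows "riesz_abs x = x"
proof -
  have "- x \<le> 0" using assms by simp
  then have "- x \<le> x" using assms by (rule order_trans)
  then show ?thesis by (simp add: riesz_abs_def sup_absorb1)
qed

lemma riesz_abs_triangle:
  fixes x y :: "'a::{ordered_real_vector, conditionally_complete_lattice}"
  shows "riesz_abs (x + y) \<le> riesz_abs x + riesz_abs y"
  using add_mono[OF riesz_abs_ge(1)[of x] riesz_abs_ge(1)[of y]]
    add_mono[OF riesz_abs_ge(2)[of x] riesz_abs_ge(2)[of y]]
  by (simp add: riesz_abs_le_iff)

lemma riesz_abs_scaleR_le:
  fixes x :: "'a::{ordered_real_vector, conditionally_complete_lattice}"
  shows "riesz_abs (r *\<^sub>R x) \<le> \<bar>r\<bar> *\<^sub>R riesz_abs x"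
proof (cases "0 \<le> r")
  case True
  then show ?thesis
    using scaleR_left_mono[OF riesz_abs_ge(1)[of x], of r] scaleR_left_mono[OF riesz_abs_ge(2)[of x], of r]
    by (simp add: riesz_abs_le_iff)
next
  case False
  then show ?thesis
    using scaleR_left_mono[OF riesz_abs_ge(1)[of x], of "-r"] scaleR_left_mono[OF riesz_abs_ge(2)[of x], of "-r"]
    by (simp add: riesz_abs_le_iff)
qed

text \<open>
  The positive cone spans the space, so linear operators are determined by their values on it.
\<close>

lemma difference_of_nonneg:
  fixes x :: "'a::{ordered_real_vector, conditionally_complete_lattice}"
  obtains a b where "0 \<le> a" "0 \<le> b" "x = a - b"
proof
  show "0 \<le> riesz_abs x" by (rule riesz_abs_nonneg)
  show "0 \<le> riesz_abs x - x" using riesz_abs_ge(1)[of x] by simp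
  show "x = riesz_abs x - (riesz_abs x - x)" by simp
qed

lemma disjoint_complement_Int_eq_0:
  fixes x :: "'a::{ordered_real_vector, conditionally_complete_lattice}"
  assumes "x \<in> B" "x \<in> disjoint_complement B"
  shows "x = 0"
proof -
  have "inf (riesz_abs x) (riesz_abs x) = 0" using assms unfolding disjoint_complement_def by blast
  then have "riesz_abs x = 0" by simp
  then show ?thesis using riesz_abs_ge[of x] by (intro antisym) auto
qed

text \<open>
  For \<open>w = inf (a + b) c\<close>, the element \<open>w - b\<close> is below both \<open>a\<close> and \<open>c\<close>, hence \<open>w \<le> b\<close>; but also
  \<open>w \<le> c\<close>.
\<close>

lemma inf_add_eq_0:
  fixes a b c :: "'a::{ordered_real_vector, conditionally_complete_lattice}"
  assumes "0 \<le> a" "0 \<le> b" "0 \<le> c" "inf a c = 0" "inf b c = 0"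
  shows "inf (a + b) c = 0"
proof (rule antisym)
  have "inf (a + b) c \<le> c + b"
    using assms(2) by (intro le_infI2) simp
  then have "inf (a + b) c - b \<le> inf a c"
    by (intro le_infI) (simp_all add: diff_le_eq)
  then have "inf (a + b) c \<le> b" using assms(4) by simp
  then show "inf (a + b) c \<le> 0" using assms(5) by (metis inf_le2 le_inf_iff)
qed (use assms in auto)

text \<open>
  A factor \<open>s \<ge> 1\<close> can be moved from \<open>a\<close> to the infimum: if \<open>0 \<le> w \<le> s a\<close> and \<open>w \<le> c\<close>, then
  \<open>w / s\<close> is below \<open>a\<close>, and below \<open>c\<close> because \<open>w / s \<le> w\<close>.
\<close>

lemma inf_scaleR_eq_0:
  fixes a c :: "'a::{ordered_real_vector, conditionally_complete_lattice}"
  assumes "0 \<le> a" "0 \<le> c" "0 \<le> r" "inf a c = 0"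
  shows "inf (r *\<^sub>R a) c = 0"
proof (rule antisym)
  \<comment> \<open>\<open>r + 1\<close> in place of \<open>r\<close> provides a factor that is at least \<open>1\<close>.\<close>
  let ?w = "inf (r *\<^sub>R a) c" and ?s = "r + 1"
  have w: "0 \<le> ?w" using assms by (simp add: scaleR_nonneg_nonneg)
  have "?w \<le> ?s *\<^sub>R a"
    using assms by (intro le_infI1) (simp add: scaleR_add_left)
  then have "(1 / ?s) *\<^sub>R ?w \<le> (1 / ?s) *\<^sub>R ?s *\<^sub>R a"
    using assms by (intro scaleR_left_mono) auto
  then have 1: "(1 / ?s) *\<^sub>R ?w \<le> a" using assms by simp
  have "(1 / ?s) *\<^sub>R ?w \<le> 1 *\<^sub>R ?w"
    using assms w by (intro scaleR_right_mono) auto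
  then have 2: "(1 / ?s) *\<^sub>R ?w \<le> c"
    by (auto intro: order_trans)
  have "(1 / ?s) *\<^sub>R ?w \<le> 0" using 1 2 assms by (metis le_inf_iff)
  then have "?s *\<^sub>R (1 / ?s) *\<^sub>R ?w \<le> ?s *\<^sub>R 0"
    using assms by (intro scaleR_left_mono) auto
  then show "?w \<le> 0" using assms by simp
qed (use assms in \<open>simp add: scaleR_nonneg_nonneg\<close>)

lemma inf_eq_0_mono:
  fixes a b c :: "'a::{ordered_real_vector, conditionally_complete_lattice}"
  assumes "0 \<le> a" "a \<le> b" "0 \<le> c" "inf b c = 0"
  shows "inf a c = 0"
proof (rule antisym)
  have "inf a c \<le> inf b c" using assms(2) by (intro inf_mono) simp_all
  then show "inf a c \<le> 0" using assms(4) by simp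
qed (use assms in simp)

lemma subspace_disjoint_complement:
  fixes B :: "'a::{ordered_real_vector, conditionally_complete_lattice} set"
  shows "subspace (disjoint_complement B)"
proof (rule subspaceI)
  show "0 \<in> disjoint_complement B"
    by (auto simp: disjoint_complement_def riesz_abs_of_nonneg riesz_abs_nonneg inf_absorb1)
next
  fix x y assume xy: "x \<in> disjoint_complement B" "y \<in> disjoint_complement B"
  show "x + y \<in> disjoint_complement B"
    unfolding disjoint_complement_def
  proof safe
    fix z assume "z \<in> B"
    then show "inf (riesz_abs (x + y)) (riesz_abs z) = 0"
      using xy inf_add_eq_0[of "riesz_abs x" "riesz_abs y" "riesz_abs z"]
      by (intro inf_eq_0_mono[OF riesz_abs_nonneg riesz_abs_triangle riesz_abs_nonneg])
        (auto simp: disjoint_complement_def riesz_abs_nonneg)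
  qed
next
  fix r :: real and x assume x: "x \<in> disjoint_complement B"
  show "r *\<^sub>R x \<in> disjoint_complement B"
    unfolding disjoint_complement_def
  proof safe
    fix z assume "z \<in> B"
    then show "inf (riesz_abs (r *\<^sub>R x)) (riesz_abs z) = 0"
      using x inf_scaleR_eq_0[of "riesz_abs x" "riesz_abs z" "\<bar>r\<bar>"]
      by (intro inf_eq_0_mono[OF riesz_abs_nonneg riesz_abs_scaleR_le riesz_abs_nonneg])
        (auto simp: disjoint_complement_def riesz_abs_nonneg)
  qed
qed

section \<open>Band projections as idempotents between zero and the identity\<close>

lemma linear_eq_on_nonneg:
  fixes f g :: "'a::{ordered_real_vector, conditionally_complete_lattice} \<Rightarrow> 'a"
  assumes "linear f" "linear g" "\<And>x. 0 \<le> x \<Longrightarrow> f x = g x"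
  shows "f x = g x"
proof -
  obtain a b where "0 \<le> a" "0 \<le> b" "x = a - b" by (rule difference_of_nonneg)
  then show ?thesis using assms by (simp add: linear_diff)
qed

lemma linear_positive_mono:
  fixes f :: "'a::{ordered_real_vector, conditionally_complete_lattice} \<Rightarrow> 'a"
  assumes "linear f" "\<And>x. 0 \<le> x \<Longrightarrow> 0 \<le> f x" "x \<le> y"
  shows "f x \<le> f y"
  using assms(2)[of "y - x"] assms(1,3) by (simp add: linear_diff)

lemma riesz_abs_linear_positive_le:
  fixes f :: "'a::{ordered_real_vector, conditionally_complete_lattice} \<Rightarrow> 'a"
  assumes "linear f" "\<And>x. 0 \<le> x \<Longrightarrow> 0 \<le> f x"
  shows "riesz_abs (f x) \<le> f (riesz_abs x)"
proof -
  have "f x \<le> f (riesz_abs x)" "f (- x) \<le> f (riesz_abs x)"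
    by (auto intro!: linear_positive_mono[of f] assms riesz_abs_ge)
  then show ?thesis using assms(1) by (simp add: riesz_abs_le_iff linear_neg)
qed

text \<open>
  The decomposition of a vector along a band and its disjoint complement is unique, since the two
  subspaces meet only in \<open>0\<close>; this gives linearity and idempotence.  If \<open>f \<ge> 0\<close>, the negative part
  of either component is dominated by the other component, from which it is disjoint, so both
  components are nonnegative.
\<close>

lemma band_projectionD:
  fixes P :: "'a::{ordered_real_vector, conditionally_complete_lattice} \<Rightarrow> 'a"
  assumes "band_projection P"
  shows band_projection_linear: "linear P"
    and band_projection_idem: "P (P f) = P f"
    and band_projection_nonneg: "0 \<le> f \<Longrightarrow> 0 \<le> P f"
    and band_projection_le: "0 \<le> f \<Longrightarrow> P f \<le> f"
proof -
  obtain B where B: "is_band B" and PB: "\<And>f. P f \<in> B"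
    and Pd: "\<And>f. f - P f \<in> disjoint_complement B"
    using assms by (auto simp: band_projection_def)
  have sB: "subspace B" using B by (simp add: is_band_def is_ideal_def)
  note sd = subspace_disjoint_complement[of B]
  have unique: "P f = g" if "g \<in> B" "f - g \<in> disjoint_complement B" for f g
  proof -
    have "(f - g) - (f - P f) \<in> disjoint_complement B"
      by (rule subspace_diff[OF sd that(2) Pd])
    moreover have "(f - g) - (f - P f) = P f - g" by simp
    moreover have "P f - g \<in> B" by (rule subspace_diff[OF sB PB that(1)])
    ultimately have "P f - g = 0"
      by (metis disjoint_complement_Int_eq_0)
    then show ?thesis by simp
  qed
  show "linear P"
  proof (rule linearI)
    fix x y and r :: real
    have "(x - P x) + (y - P y) \<in> disjoint_complement B"
      by (rule subspace_add[OF sd Pd Pd])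
    then show "P (x + y) = P x + P y"
      by (intro unique subspace_add[OF sB] PB) (simp add: algebra_simps)
    have "r *\<^sub>R (x - P x) \<in> disjoint_complement B"
      by (rule subspace_scale[OF sd Pd])
    then show "P (r *\<^sub>R x) = r *\<^sub>R P x"
      by (intro unique subspace_scale[OF sB] PB) (simp add: algebra_simps)
  qed
  show "P (P f) = P f"
    by (intro unique PB) (simp add: subspace_0[OF sd])
  have disj: "inf (riesz_abs (f - P f)) (riesz_abs (P f)) = 0"
    using PB Pd by (auto simp: disjoint_complement_def)
  assume f: "0 \<le> f"
  have "- P f \<le> f - P f" using f by simp
  then have "- P f \<le> riesz_abs (f - P f)"
    using riesz_abs_ge(1) by (rule order_trans)
  then have "- P f \<le> 0"
    using le_infI[OF _ riesz_abs_ge(2)] disj by metis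
  then show "0 \<le> P f" by simp
  have "- (f - P f) \<le> P f" using f by simp
  then have "- (f - P f) \<le> riesz_abs (P f)"
    using riesz_abs_ge(1) by (rule order_trans)
  then have "- (f - P f) \<le> 0"
    using le_infI[OF riesz_abs_ge(2)] disj by metis
  then show "P f \<le> f" by simp
qed

lemma band_projection_mono:
  fixes P :: "'a::{ordered_real_vector, conditionally_complete_lattice} \<Rightarrow> 'a"
  assumes "band_projection P" "x \<le> y"
  shows "P x \<le> P y"
  using linear_positive_mono[OF band_projection_linear[OF assms(1)]
      band_projection_nonneg[OF assms(1)] assms(2)] .

text \<open>
  Both \<open>P\<close> and \<open>I - P\<close> are positive.  If \<open>P y = y\<close>, then \<open>I - P\<close> is nonpositive on \<open>\<bar>y\<bar>\<close>, hence on
  every smaller modulus \<open>\<bar>x\<bar>\<close>, and so annihilates \<open>x\<close>.  For the supremum of a set of fixed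
  points, one inequality is monotonicity of \<open>P\<close>, the other is \<open>P \<le> I\<close> at the nonnegative difference of
  the supremum and some member of the set.
\<close>

lemma is_band_fixed_points:
  fixes P :: "'a::{ordered_real_vector, conditionally_complete_lattice} \<Rightarrow> 'a"
  assumes lin: "linear P"
    and nonneg: "\<And>f. 0 \<le> f \<Longrightarrow> 0 \<le> P f" and le: "\<And>f. 0 \<le> f \<Longrightarrow> P f \<le> f"
  shows "is_band {x. P x = x}"
  unfolding is_band_def is_ideal_def
proof (intro conjI allI impI)
  show "subspace {x. P x = x}"
    using lin by (auto simp: subspace_def linear_0 linear_add linear_scale)
  fix x y assume "y \<in> {x. P x = x} \<and> riesz_abs x \<le> riesz_abs y"
  then have y: "P y = y" and xy: "riesz_abs x \<le> riesz_abs y" by auto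
  have linC: "linear (\<lambda>f. f - P f)" using lin by (intro linear_compose_sub linear_ident)
  have posC: "\<And>f. 0 \<le> f \<Longrightarrow> 0 \<le> f - P f" using le by simp
  have "riesz_abs (x - P x) \<le> riesz_abs x - P (riesz_abs x)"
    by (rule riesz_abs_linear_positive_le[OF linC posC])
  also have "\<dots> \<le> riesz_abs y - P (riesz_abs y)"
    by (rule linear_positive_mono[OF linC posC xy])
  also have "\<dots> \<le> 0"
    using riesz_abs_linear_positive_le[OF lin nonneg, of y] y by simp
  finally have "x - P x \<le> 0" "- (x - P x) \<le> 0" by (simp_all add: riesz_abs_le_iff)
  then show "x \<in> {x. P x = x}" by (simp add: antisym)
next
  have mono: "\<And>x y. x \<le> y \<Longrightarrow> P x \<le> P y"
    by (rule linear_positive_mono[OF lin nonneg])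
  fix A assume "A \<subseteq> {x. P x = x} \<and> A \<noteq> {} \<and> bdd_above A"
  then have A: "\<And>a. a \<in> A \<Longrightarrow> P a = a" "A \<noteq> {}" "bdd_above A" by auto
  have "Sup A \<le> P (Sup A)"
  proof (rule cSup_least)
    fix a assume a: "a \<in> A"
    then have "P a \<le> P (Sup A)" using A by (intro mono cSup_upper)
    then show "a \<le> P (Sup A)" using A(1)[OF a] by simp
  qed (rule A)
  moreover have "P (Sup A) \<le> Sup A"
  proof -
    obtain a where a: "a \<in> A" using A by auto
    then have "P (Sup A - a) \<le> Sup A - a"
      using A by (intro le) (simp add: cSup_upper)
    then show ?thesis using A(1)[OF a] lin by (simp add: linear_diff)
  qed
  ultimately show "Sup A \<in> {x. P x = x}" by simp
qed

text \<open>
  Together with \<open>band_projectionD\<close> this characterizes band projections without reference to a band.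
  The band is the set of fixed points: an element below \<open>\<bar>f - P f\<bar>\<close> and the modulus of a fixed point
  is itself a fixed point, yet \<open>P\<close> sends it below \<open>P (\<bar>f\<bar> - P \<bar>f\<bar>) = 0\<close>.
\<close>

lemma band_projectionI:
  fixes P :: "'a::{ordered_real_vector, conditionally_complete_lattice} \<Rightarrow> 'a"
  assumes lin: "linear P" and idem: "\<And>f. P (P f) = P f"
    and nonneg: "\<And>f. 0 \<le> f \<Longrightarrow> 0 \<le> P f" and le: "\<And>f. 0 \<le> f \<Longrightarrow> P f \<le> f"
  shows "band_projection P"
  unfolding band_projection_def
proof (intro exI conjI allI)
  let ?B = "{x. P x = x}"
  show band: "is_band ?B" using lin nonneg le by (rule is_band_fixed_points)
  fix f
  show "P f \<in> ?B" using idem by simp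
  show "f - P f \<in> disjoint_complement ?B"
    unfolding disjoint_complement_def
  proof safe
    fix b assume b: "P b = b"
    let ?w = "inf (riesz_abs (f - P f)) (riesz_abs b)"
    have w0: "0 \<le> ?w" by (simp add: riesz_abs_nonneg)
    have "riesz_abs ?w \<le> riesz_abs b" by (simp add: riesz_abs_of_nonneg[OF w0])
    then have "?w \<in> ?B" using band b unfolding is_band_def is_ideal_def by blast
    then have w: "P ?w = ?w" by simp
    have "riesz_abs (f - P f) \<le> riesz_abs f - P (riesz_abs f)"
      by (rule riesz_abs_linear_positive_le) (use lin le in \<open>auto intro: linear_compose_sub linear_ident\<close>)
    then have "?w \<le> riesz_abs f - P (riesz_abs f)" by (rule le_infI1)
    then have "P ?w \<le> P (riesz_abs f - P (riesz_abs f))"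
      by (rule linear_positive_mono[OF lin nonneg, rotated])
    also have "\<dots> = 0" using lin idem by (simp add: linear_diff)
    finally show "?w = 0" unfolding w using w0 by (rule antisym)
  qed
qed

lemma band_projection_complement:
  fixes P :: "'a::{ordered_real_vector, conditionally_complete_lattice} \<Rightarrow> 'a"
  assumes "band_projection P"
  shows "band_projection (\<lambda>f. f - P f)"
  using band_projectionD[OF assms]
  by (intro band_projectionI linear_compose_sub linear_ident) (auto simp: linear_diff)

lemma is_band_kernel:
  fixes P :: "'a::{ordered_real_vector, conditionally_complete_lattice} \<Rightarrow> 'a"
  assumes "band_projection P"
  shows "is_band {x. P x = 0}"
proof -
  have "is_band {x. x - P x = x}"
    using band_projectionD(1,3,4)[OF band_projection_complement[OF assms]]
    by (rule is_band_fixed_points)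
  then show ?thesis by simp
qed

text \<open>
  \<open>Q g \<le> g\<close> shows that \<open>Q\<close> maps the positive parts of the kernel and of the range of \<open>P\<close> into
  themselves; hence \<open>P Q = P Q P = Q P\<close>.
\<close>

lemma band_projection_commute:
  fixes P Q :: "'a::{ordered_real_vector, conditionally_complete_lattice} \<Rightarrow> 'a"
  assumes P: "band_projection P" and Q: "band_projection Q"
  shows "P (Q f) = Q (P f)"
proof (rule linear_eq_on_nonneg[of "\<lambda>f. P (Q f)" "\<lambda>f. Q (P f)"])
  note p = band_projectionD[OF P] and q = band_projectionD[OF Q]
  show "linear (\<lambda>f. P (Q f))" "linear (\<lambda>f. Q (P f))"
    using linear_compose[OF q(1) p(1)] linear_compose[OF p(1) q(1)] by (simp_all add: o_def)
  fix f :: 'a assume f: "0 \<le> f"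
  have "0 \<le> f - P f" using p(4)[OF f] by simp
  note g = q(3,4)[OF this]
  have "P (Q (f - P f)) \<le> P (f - P f)" by (rule band_projection_mono[OF P g(2)])
  also have "\<dots> = 0" using p(1,2) by (simp add: linear_diff)
  finally have "P (Q (f - P f)) = 0" using p(3)[OF g(1)] by (rule antisym)
  then have 1: "P (Q f) = P (Q (P f))" using p(1) q(1) by (simp add: linear_diff)
  have "Q (P f) - P (Q (P f)) \<le> P f - P (P f)"
    using p(4)[of "P f - Q (P f)"] q(4)[of "P f"] p(3)[OF f] p(1)
    by (simp add: linear_diff algebra_simps)
  moreover have "P (Q (P f)) \<le> Q (P f)"
    using p q f by simp
  ultimately show "P (Q f) = Q (P f)"
    using 1 p(2) by simp
qed

lemma band_projection_eq_0:
  fixes P :: "'a::{ordered_real_vector, conditionally_complete_lattice} \<Rightarrow> 'a"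
  assumes "band_projection P" "weak_order_unit u" "P u = 0"
  shows "P f = 0"
proof -
  have "is_band hull {u} \<subseteq> {x. P x = 0}"
    using assms by (intro hull_minimal is_band_kernel) auto
  then show ?thesis using assms(2) by (auto simp: weak_order_unit_def)
qed

section \<open>Suprema of band projections\<close>

text \<open>
  For \<open>f \<ge> 0\<close> the projection is the largest element \<open>g\<close> of the band between \<open>0\<close> and \<open>f\<close>.  If some
  \<open>w \<ge> 0\<close> in the band were below \<open>f - g\<close>, then \<open>z + w\<close> would be a competitor for each competitor
  \<open>z\<close>, so that \<open>g + w \<le> g\<close>.
\<close>

lemma band_projection_onto:
  fixes Z :: "'a::{ordered_real_vector, conditionally_complete_lattice} set"
  assumes Z: "is_band Z"
  obtains P where "band_projection P" "\<And>f. P f \<in> Z" "\<And>z. z \<in> Z \<Longrightarrow> P z = z"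
proof -
  have sZ: "subspace Z" and ideal: "\<And>x y. y \<in> Z \<Longrightarrow> riesz_abs x \<le> riesz_abs y \<Longrightarrow> x \<in> Z"
    and Sup: "\<And>A. A \<subseteq> Z \<Longrightarrow> A \<noteq> {} \<Longrightarrow> bdd_above A \<Longrightarrow> Sup A \<in> Z"
    using Z by (auto simp: is_band_def is_ideal_def)
  note sd = subspace_disjoint_complement[of Z]
  have pos: "\<exists>g\<in>Z. f - g \<in> disjoint_complement Z" if f: "0 \<le> f" for f
  proof
    let ?A = "{z \<in> Z. 0 \<le> z \<and> z \<le> f}"
    have A: "?A \<noteq> {}" "bdd_above ?A"
      using subspace_0[OF sZ] f by (auto intro: bdd_aboveI)
    show g: "Sup ?A \<in> Z" using A by (intro Sup) auto
    have gf: "Sup ?A \<le> f" using A by (intro cSup_least) auto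
    show "f - Sup ?A \<in> disjoint_complement Z"
      unfolding disjoint_complement_def
    proof safe
      fix b assume b: "b \<in> Z"
      let ?w = "inf (riesz_abs (f - Sup ?A)) (riesz_abs b)"
      have w0: "0 \<le> ?w" by (simp add: riesz_abs_nonneg)
      have wZ: "?w \<in> Z"
        using b riesz_abs_of_nonneg[OF w0] by (intro ideal[OF b]) simp
      have wf: "?w \<le> f - Sup ?A"
        using gf by (intro le_infI1) (simp add: riesz_abs_of_nonneg)
      have "z \<le> Sup ?A - ?w" if z: "z \<in> ?A" for z
      proof -
        have "z + ?w \<le> Sup ?A + (f - Sup ?A)"
          using z A wf by (intro add_mono cSup_upper)
        then have "z + ?w \<in> ?A"
          using z w0 wZ subspace_add[OF sZ] by auto
        then show ?thesis using A by (simp add: le_diff_eq cSup_upper)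
      qed
      then have "Sup ?A \<le> Sup ?A - ?w" using A by (intro cSup_least)
      then show "?w = 0" using w0 by simp
    qed
  qed
  have "\<exists>g. g \<in> Z \<and> f - g \<in> disjoint_complement Z" for f
  proof -
    obtain a b where ab: "0 \<le> a" "0 \<le> b" "f = a - b" by (rule difference_of_nonneg)
    then obtain g h where gh: "g \<in> Z" "a - g \<in> disjoint_complement Z"
      "h \<in> Z" "b - h \<in> disjoint_complement Z" using pos by metis
    have "(a - g) - (b - h) \<in> disjoint_complement Z" by (rule subspace_diff[OF sd gh(2,4)])
    moreover have "(a - g) - (b - h) = f - (g - h)" using ab by simp
    ultimately show ?thesis
      using subspace_diff[OF sZ gh(1,3)] by metis
  qed
  then obtain P where P: "\<And>f. P f \<in> Z" "\<And>f. f - P f \<in> disjoint_complement Z" by metis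
  have "P z = z" if "z \<in> Z" for z
  proof -
    have "z - P z \<in> Z" by (rule subspace_diff[OF sZ that P(1)])
    then have "z - P z = 0"
      using P(2)[of z] by (rule disjoint_complement_Int_eq_0)
    then show ?thesis by simp
  qed
  moreover have "band_projection P" using P Z by (auto simp: band_projection_def)
  ultimately show thesis using P that by blast
qed

text \<open>
  With \<open>N\<close> the projection onto the intersection of the kernels, \<open>I - N\<close> is the supremum: for an
  upper bound \<open>R\<close> and \<open>f \<ge> 0\<close>, each \<open>P\<close> in \<open>S\<close> annihilates \<open>f - R f\<close>, so \<open>N\<close> fixes it and
  \<open>f - R f \<le> N f\<close>.  The second conclusion is specific to this construction and is how the
  supremum gets bounded from above later.
\<close>

lemma band_projection_Sup_exists:
  fixes S :: "('a::{ordered_real_vector, conditionally_complete_lattice} \<Rightarrow> 'a) set"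
  assumes S: "\<And>P. P \<in> S \<Longrightarrow> band_projection P"
  obtains Q where "is_band_projection_Sup S Q" "\<And>w. (\<And>P. P \<in> S \<Longrightarrow> P w = 0) \<Longrightarrow> Q w = 0"
proof -
  define Z where "Z = {x. \<forall>P\<in>S. P x = 0}"
  have ker: "\<And>P. P \<in> S \<Longrightarrow> is_band {x. P x = 0}" using S is_band_kernel by blast
  have "is_band Z"
    unfolding is_band_def is_ideal_def
  proof (intro conjI allI impI)
    show "subspace Z"
      using ker unfolding Z_def is_band_def is_ideal_def subspace_def by auto
    fix x y assume "y \<in> Z \<and> riesz_abs x \<le> riesz_abs y"
    then show "x \<in> Z" using ker unfolding Z_def is_band_def is_ideal_def by blast
  next
    fix A assume A: "A \<subseteq> Z \<and> A \<noteq> {} \<and> bdd_above A"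
    have "Sup A \<in> {x. P x = 0}" if "P \<in> S" for P
    proof -
      have "A \<subseteq> {x. P x = 0}" using A that by (auto simp: Z_def)
      then show ?thesis using ker[OF that] A unfolding is_band_def by blast
    qed
    then show "Sup A \<in> Z" by (auto simp: Z_def)
  qed
  then obtain N where N: "band_projection N" "\<And>f. N f \<in> Z" "\<And>z. z \<in> Z \<Longrightarrow> N z = z"
    by (rule band_projection_onto) blast
  note n = band_projectionD[OF N(1)]
  have "is_band_projection_Sup S (\<lambda>f. f - N f)"
    unfolding is_band_projection_Sup_def
  proof (intro conjI ballI allI impI)
    show "band_projection (\<lambda>f. f - N f)" using N(1) by (rule band_projection_complement)
  next
    fix P assume P: "P \<in> S"
    note p = band_projectionD[OF S[OF P]]
    show "op_le P (\<lambda>f. f - N f)"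
      unfolding op_le_def
    proof (intro allI impI)
      fix f :: 'a assume f: "0 \<le> f"
      have "P (N f) = 0" using N(2) P by (auto simp: Z_def)
      then have "P f = P (f - N f)" using p(1) by (simp add: linear_diff)
      also have "\<dots> \<le> f - N f" using f n by (intro p(4)) simp
      finally show "P f \<le> f - N f" .
    qed
  next
    fix R assume R: "band_projection R \<and> (\<forall>P\<in>S. op_le P R)"
    note r = band_projectionD[OF conjunct1[OF R]]
    show "op_le (\<lambda>f. f - N f) R"
      unfolding op_le_def
    proof (intro allI impI)
      fix f :: 'a assume f: "0 \<le> f"
      have f': "0 \<le> f - R f" using r f by simp
      have "P (f - R f) = 0" if "P \<in> S" for P
      proof (rule antisym)
        have "P (f - R f) \<le> R (f - R f)" using R that f' by (auto simp: op_le_def)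
        then show "P (f - R f) \<le> 0" using r by (simp add: linear_diff)
        show "0 \<le> P (f - R f)" using band_projectionD[OF S[OF that]] f' by simp
      qed
      then have "N (f - R f) = f - R f" by (intro N(3)) (simp add: Z_def)
      moreover have "N (f - R f) \<le> N f"
        using r(3)[OF f] by (simp add: band_projection_mono[OF N(1)])
      ultimately have "f - R f \<le> N f" by simp
      then show "f - N f \<le> R f" by (simp add: algebra_simps)
    qed
  qed
  moreover have "w - N w = 0" if "\<And>P. P \<in> S \<Longrightarrow> P w = 0" for w
    using that N(3)[of w] by (simp add: Z_def)
  ultimately show thesis using that by blast
qed

section \<open>Products of complementary projections\<close>

lemma complement_prod_0 [simp]: "complement_prod P n 0 f = f"
  by (simp add: complement_prod_def)

lemma complement_prod_add:
  "complement_prod P n (i + j) f = complement_prod P n i (complement_prod P (n + i) j f)"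
  using upt_add_eq_append[of n "n + i" j] by (simp add: complement_prod_def add.assoc)

lemma complement_prod_Suc:
  "complement_prod P n (Suc i) f = complement_prod P n i (f - P (n + i) f)"
  by (simp add: complement_prod_def)

lemma band_projection_complement_prod:
  fixes P :: "nat \<Rightarrow> 'a::{ordered_real_vector, conditionally_complete_lattice} \<Rightarrow> 'a"
  assumes "\<And>j. j \<ge> n \<Longrightarrow> band_projection (P j)"
  shows "band_projection (complement_prod P n i)"
proof (induction i)
  case 0
  have "complement_prod P n 0 = (\<lambda>f. f)" by (rule ext) simp
  moreover have "band_projection (\<lambda>f::'a. f)" by (rule band_projectionI) (simp_all add: linear_ident)
  ultimately show ?case by simp
next
  case (Suc i)
  let ?C = "complement_prod P n i" and ?R = "\<lambda>f. f - P (n + i) f"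
  have R: "band_projection ?R" by (rule band_projection_complement[OF assms[OF le_add1]])
  note c = band_projectionD[OF Suc] and r = band_projectionD[OF R]
  note comm = band_projection_commute[OF R Suc]
  have eq: "complement_prod P n (Suc i) = (\<lambda>f. ?C (?R f))"
    by (rule ext) (rule complement_prod_Suc)
  show ?case
    unfolding eq
  proof (rule band_projectionI)
    show "linear (\<lambda>f. ?C (?R f))" using linear_compose[OF r(1) c(1)] by (simp add: o_def)
    fix f
    have "?C (?R (?C (?R f))) = ?C (?C (?R (?R f)))"
      by (rule arg_cong[of _ _ ?C]) (rule comm)
    also have "\<dots> = ?C (?R (?R f))" by (rule c(2))
    also have "\<dots> = ?C (?R f)" by (rule arg_cong[of _ _ ?C]) (rule r(2))
    finally show "?C (?R (?C (?R f))) = ?C (?R f)" .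
    assume f: "0 \<le> f"
    show "0 \<le> ?C (?R f)" by (rule c(3)[OF r(3)[OF f]])
    show "?C (?R f) \<le> f" by (rule order_trans[OF c(4)[OF r(3)[OF f]] r(4)[OF f]])
  qed
qed

context
  fixes P :: "nat \<Rightarrow> 'a::{ordered_real_vector, conditionally_complete_lattice} \<Rightarrow> 'a"
    and e :: 'a and k :: nat
  assumes proj: "\<forall>j\<ge>k. band_projection (P j)"
    and e_nonneg: "0 \<le> e"
begin

lemma projections_from:
  assumes "n \<ge> k"
  shows "band_projection (P n)" "band_projection (complement_prod P n i)"
  using assms proj by (auto intro: band_projection_complement_prod)

lemma complement_prod_nonneg: "n \<ge> k \<Longrightarrow> 0 \<le> complement_prod P n i e"
  by (rule band_projection_nonneg[OF projections_from(2) e_nonneg])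

lemma complement_prod_antimono: "complement_prod P k (i + j) e \<le> complement_prod P k i e"
  unfolding complement_prod_add
  by (rule band_projection_mono[OF projections_from(2)[OF order_refl]
        band_projection_le[OF projections_from(2)[OF le_add1] e_nonneg]])

lemma projection_complement_prod_eq_0:
  assumes "k \<le> j" "j < k + i"
  shows "P j (complement_prod P k i e) = 0"
proof -
  define a where "a = j - k"
  define b where "b = i - Suc a"
  let ?C = "complement_prod P k a" and ?g = "complement_prod P (Suc j) b e"
  have i: "i = a + Suc b" and j: "j = k + a" using assms by (auto simp: a_def b_def)
  have pj: "band_projection (P j)" using assms(1) by (rule projections_from(1))
  have "complement_prod P j (Suc b) e = ?g - P j ?g"
    using complement_prod_add[of P j 1 b e] by (simp add: complement_prod_def)
  moreover have "complement_prod P k i e = ?C (complement_prod P j (Suc b) e)"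
    unfolding i j by (rule complement_prod_add)
  ultimately have "P j (complement_prod P k i e) = P j (?C (?g - P j ?g))" by simp
  also have "\<dots> = ?C (P j (?g - P j ?g))"
    by (rule band_projection_commute[OF projections_from(1)[OF assms(1)] projections_from(2)[OF order_refl]])
  also have "P j (?g - P j ?g) = 0"
    using band_projection_linear[OF pj] band_projection_idem[OF pj] by (simp add: linear_diff)
  also have "?C 0 = 0"
    using band_projection_linear[OF projections_from(2)[OF order_refl]] by (rule linear_0)
  finally show ?thesis .
qed

lemma complement_prod_step:
  "complement_prod P k i e - complement_prod P k (Suc i) e = complement_prod P k i (P (k + i) e)"
  unfolding complement_prod_Suc
  by (simp add: linear_diff[OF band_projection_linear[OF projections_from(2)[OF order_refl]]])

lemma complement_prod_initial:
  "e - complement_prod P k i e \<le> (\<Sum>j\<in>{k..<k+i}. P j e)"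
proof (induction i)
  case (Suc i)
  have "complement_prod P k i (P (k + i) e) \<le> P (k + i) e"
    by (rule band_projection_le[OF projections_from(2)[OF order_refl]
          band_projection_nonneg[OF projections_from(1)[OF le_add1] e_nonneg]])
  then have "complement_prod P k i e - complement_prod P k (Suc i) e \<le> P (k + i) e"
    by (simp add: complement_prod_step)
  from add_mono[OF Suc this] show ?case by simp
qed simp

text \<open>
  The step at time \<open>k + m + i\<close> applies all factors from time \<open>k\<close> on; dropping the first \<open>i\<close> of them
  increases the result and leaves only the last \<open>m\<close>, through which the projection commutes.
\<close>

lemma complement_prod_later:
  "complement_prod P k m e - complement_prod P k (m + i) e
    \<le> (\<Sum>n\<in>{k..<k+i}. P (n + m) (complement_prod P n m e))"
proof (induction i)
  case (Suc i)
  let ?R = "P (k + i + m)"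
  have R: "band_projection ?R" and kn: "k \<le> k + i" using proj by auto
  have idx: "k + (m + i) = k + i + m" by simp
  have "complement_prod P k (m + i) (?R e)
      = complement_prod P k i (complement_prod P (k + i) m (?R e))"
    unfolding add.commute[of m] by (rule complement_prod_add)
  also have "\<dots> \<le> complement_prod P (k + i) m (?R e)"
    by (rule band_projection_le[OF projections_from(2)[OF order_refl] band_projection_nonneg[OF
          projections_from(2)[OF kn] band_projection_nonneg[OF R e_nonneg]]])
  also have "\<dots> = ?R (complement_prod P (k + i) m e)"
    by (rule band_projection_commute[OF projections_from(2)[OF kn] R])
  finally have "complement_prod P k (m + i) e - complement_prod P k (m + Suc i) e
      \<le> ?R (complement_prod P (k + i) m e)"
    unfolding add_Suc_right[of m] complement_prod_step idx .
  from add_mono[OF Suc this] show ?case by simp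
qed simp

text \<open>
  The infimum is the part of \<open>e\<close> missed by all the projections, so the supremum \<open>Q\<close> retains at most
  the rest.
\<close>

lemma Sup_projection_bound:
  assumes "is_band_projection_Sup (P ` {k..}) Q"
    and Q0: "\<And>w. (\<And>R. R \<in> P ` {k..} \<Longrightarrow> R w = 0) \<Longrightarrow> Q w = 0"
  shows "Q e \<le> e - (INF i. complement_prod P k i e)"
proof -
  let ?c = "INF i. complement_prod P k i e"
  have bdd: "bdd_below (range (\<lambda>i. complement_prod P k i e))"
    using complement_prod_nonneg by (auto intro: bdd_belowI[of _ 0])
  have c0: "0 \<le> ?c" using complement_prod_nonneg by (intro cINF_greatest) auto
  have "P n ?c = 0" if n: "n \<ge> k" for n
  proof (rule antisym)
    \<comment> \<open>The product of length \<open>n - k + 1\<close> is the first to contain the factor \<open>I - P n\<close>.\<close>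
    have "?c \<le> complement_prod P k (Suc (n - k)) e" using bdd by (intro cINF_lower) auto
    then have "P n ?c \<le> P n (complement_prod P k (Suc (n - k)) e)"
      by (rule band_projection_mono[OF projections_from(1)[OF n]])
    then show "P n ?c \<le> 0" using n by (simp add: projection_complement_prod_eq_0)
    show "0 \<le> P n ?c" by (rule band_projection_nonneg[OF projections_from(1)[OF n] c0])
  qed
  then have "Q ?c = 0" by (intro Q0) auto
  have Q: "band_projection Q" using assms by (simp add: is_band_projection_Sup_def)
  have "?c \<le> e" using cINF_lower[OF bdd UNIV_I, of 0] by simp
  then have "Q (e - ?c) \<le> e - ?c" by (simp add: band_projection_le[OF Q])
  then show ?thesis using band_projection_linear[OF Q] \<open>Q ?c = 0\<close> by (simp add: linear_diff)
qed

end

section \<open>The Borel--Cantelli estimate\<close>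

text \<open>
  Order continuity in the form in which it is used: an upper bound for the images of an increasing
  sequence \<open>a - c\<^sub>i\<close> bounds the image of its supremum.
\<close>

lemma order_continuous_INF_le:
  fixes T :: "'a::{ordered_real_vector, conditionally_complete_lattice} \<Rightarrow> 'a" and c :: "nat \<Rightarrow> 'a"
  assumes T: "linear T" "order_continuous T"
    and dec: "\<And>i j. i \<le> j \<Longrightarrow> c j \<le> c i" and bdd: "bdd_below (range c)"
    and b: "\<And>i. T (a - c i) \<le> b"
  shows "T (a - (INF i. c i)) \<le> b"
proof -
  let ?I = "INF i. c i" and ?D = "range (\<lambda>i. c i - (INF i. c i))"
  have low: "?I \<le> c i" for i using bdd by (intro cINF_lower) auto
  then have bD: "bdd_below ?D" by (auto intro: bdd_belowI[of _ 0])
  have "Inf ?D = 0"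
  proof (rule cInf_eq_non_empty)
    fix y assume y: "\<And>x. x \<in> ?D \<Longrightarrow> y \<le> x"
    have "y \<le> c i - ?I" for i by (rule y) (rule rangeI)
    then have "y + ?I \<le> c i" for i by (simp add: le_diff_eq)
    then have "y + ?I \<le> ?I" by (intro cINF_greatest) auto
    then show "y \<le> 0" by simp
  qed (use low in auto)
  moreover have "\<exists>z\<in>?D. z \<le> x \<and> z \<le> y" if xy: "x \<in> ?D" "y \<in> ?D" for x y
  proof -
    obtain i j where "x = c i - ?I" "y = c j - ?I" using xy by blast
    then show ?thesis
      using dec[of i "max i j"] dec[of j "max i j"] by (intro bexI[of _ "c (max i j) - ?I"]) auto
  qed
  ultimately have "?D \<noteq> {} \<and> (\<forall>x\<in>?D. \<forall>y\<in>?D. \<exists>z\<in>?D. z \<le> x \<and> z \<le> y) \<and> bdd_below ?D \<and> Inf ?D = 0"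
    using bD by (intro conjI ballI) simp_all
  then have inf: "Inf (T ` ?D) = 0"
    using T(2) unfolding order_continuous_def by (elim allE[of _ ?D]) simp
  have "T (a - ?I) - b \<le> x" if x: "x \<in> T ` ?D" for x
  proof -
    obtain i where "x = T (c i - ?I)" using x by blast
    then show ?thesis using b[of i] T(1) by (simp add: linear_diff algebra_simps)
  qed
  then have "T (a - ?I) - b \<le> Inf (T ` ?D)" by (intro cInf_greatest) auto
  then show ?thesis using inf by simp
qed

text \<open>
  The bounds on \<open>y\<close> are stated through an arbitrary upper bound \<open>b\<close> of the partial sums, which avoids
  naming the sum of the tail.  With \<open>u\<^sub>k\<close> the supremum of the \<open>p\<^sub>n\<close> for \<open>n \<ge> k\<close>, the terms \<open>p\<^sub>j\<close> contribute
  at most \<open>m u\<^sub>k\<close> and the terms \<open>t\<^sub>n\<close> at most \<open>l - S\<^bsub>k-1\<^esub>\<close>.  Since \<open>u\<close> decreases, \<open>k\<close> may be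
  kept fixed in the first term while it grows in the second, which yields \<open>y \<le> m u\<^sub>k\<close>; then \<open>k\<close> grows.
\<close>

lemma nonpos_of_order_null_bounds:
  fixes y :: "'a::{ordered_real_vector, conditionally_complete_lattice}" and p t :: "nat \<Rightarrow> 'a"
  assumes p: "order_converges_to p 0" and t: "series_order_convergent t"
    and t0: "\<And>n. n \<ge> 1 \<Longrightarrow> 0 \<le> t n" and m: "m \<ge> 1"
    and y: "\<And>k b. k \<ge> 1 \<Longrightarrow> (\<And>i. (\<Sum>j\<in>{k..<k+m}. p j) + (\<Sum>n\<in>{k..<k+i}. t n) \<le> b) \<Longrightarrow> y \<le> b"
  shows "y \<le> 0"
proof -
  define S where "S N = (\<Sum>n=1..N. t n)" for N
  define l where "l = (SUP N\<in>{1..}. S N)"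
  define u where "u k = (SUP n\<in>{k..}. p n)" for k
  have bS: "bdd_above (S ` {1..})"
    using t by (auto simp: series_order_convergent_def order_converges_to_def S_def)
  have Smono: "S i \<le> S j" if "i \<le> j" for i j
    unfolding S_def using that t0 by (intro sum_mono2) auto
  have Sl: "S N \<le> l" for N
  proof -
    have "S N \<le> S (max 1 N)" by (rule Smono) simp
    also have "\<dots> \<le> l" unfolding l_def by (rule cSUP_upper[OF _ bS]) simp
    finally show ?thesis .
  qed
  have bp: "bdd_above (p ` {1..})" and u0: "(INF k\<in>{1..}. u k) = 0"
    using p by (auto simp: order_converges_to_def u_def)
  have pu: "p n \<le> u k" if "k \<ge> 1" "n \<ge> k" for n k
    unfolding u_def using that by (intro cSUP_upper bdd_above_mono[OF bp]) auto
  have umono: "u j \<le> u i" if "1 \<le> i" "i \<le> j" for i j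
    unfolding u_def using that by (intro cSUP_subset_mono bdd_above_mono[OF bp]) auto
  have main: "y \<le> real m *\<^sub>R u k + (l - S (k - 1))" if k: "k \<ge> 1" for k
  proof (rule y[OF k])
    fix i
    have "(\<Sum>j\<in>{k..<k+m}. p j) \<le> (\<Sum>j\<in>{k..<k+m}. u k)"
      using k by (intro sum_mono pu) auto
    also have "\<dots> = real m *\<^sub>R u k" by (simp add: sum_constant_scaleR)
    finally have 1: "(\<Sum>j\<in>{k..<k+m}. p j) \<le> real m *\<^sub>R u k" .
    have split: "{1..k + i - 1} = {1..k-1} \<union> {k..<k+i}" using k by auto
    have "S (k + i - 1) = S (k - 1) + (\<Sum>n\<in>{k..<k+i}. t n)"
      unfolding S_def split by (rule sum.union_disjoint) auto
    then have "(\<Sum>n\<in>{k..<k+i}. t n) \<le> l - S (k - 1)"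
      using Sl[of "k + i - 1"] by (simp add: algebra_simps)
    from add_mono[OF 1 this]
    show "(\<Sum>j\<in>{k..<k+m}. p j) + (\<Sum>n\<in>{k..<k+i}. t n) \<le> real m *\<^sub>R u k + (l - S (k - 1))" .
  qed
  have "y \<le> real m *\<^sub>R u k" if k: "k \<ge> 1" for k
  proof -
    have "S N \<le> real m *\<^sub>R u k + l - y" for N
    proof -
      let ?k = "max k (Suc N)"
      have "y \<le> real m *\<^sub>R u ?k + (l - S (?k - 1))" using k by (intro main) auto
      also have "\<dots> \<le> real m *\<^sub>R u k + (l - S N)"
        using k by (intro add_mono scaleR_left_mono umono diff_left_mono Smono) auto
      finally show ?thesis by (simp add: algebra_simps)
    qed
    then have "l \<le> real m *\<^sub>R u k + l - y" unfolding l_def by (intro cSUP_least) auto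
    then show ?thesis by (simp add: algebra_simps)
  qed
  then have "(1 / real m) *\<^sub>R y \<le> u k" if "k \<ge> 1" for k
    using scaleR_left_mono[of y "real m *\<^sub>R u k" "1 / real m"] m that by simp
  then have "(1 / real m) *\<^sub>R y \<le> (INF k\<in>{1..}. u k)" by (intro cINF_greatest) auto
  then have "(1 / real m) *\<^sub>R y \<le> 0" unfolding u0 .
  then have "real m *\<^sub>R (1 / real m) *\<^sub>R y \<le> real m *\<^sub>R 0"
    by (intro scaleR_left_mono) auto
  then show ?thesis using m by simp
qed

section \<open>Vanishing of the limit superior\<close>

theorem theorem4p3:
  fixes T :: "'a::{ordered_real_vector, conditionally_complete_lattice} \<Rightarrow> 'a"
    and e :: 'a
    and P :: "nat \<Rightarrow> 'a \<Rightarrow> 'a"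
    and m :: nat
  assumes "conditional_expectation T"
    and "strictly_positive T"
    and "weak_order_unit e"
    and "T e = e"
    and "\<And>n. n \<ge> 1 \<Longrightarrow> band_projection (P n)"
    and "order_converges_to (\<lambda>n. T (P n e)) 0"
    and "m \<ge> 1"
    and "series_order_convergent (\<lambda>n. T (P (n + m) (complement_prod P n m e)))"
  shows "is_band_projection_limsup P (\<lambda>f. 0)"
proof -
  have T: "linear T" "order_continuous T" "\<And>f. 0 \<le> f \<Longrightarrow> 0 \<le> T f"
    using assms(1) by (auto simp: conditional_expectation_def positive_op_def)
  have Tmono: "\<And>x y. x \<le> y \<Longrightarrow> T x \<le> T y"
    by (rule linear_positive_mono[OF T(1,3)])
  have e: "0 \<le> e" using assms(3) by (simp add: weak_order_unit_def)
  have proj: "\<forall>j\<ge>k. band_projection (P j)" if "k \<ge> 1" for k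
    using assms(5) that by simp
  have "\<forall>k\<ge>1. \<exists>Q. is_band_projection_Sup (P ` {k..}) Q
      \<and> Q e \<le> e - (INF i. complement_prod P k i e)"
  proof (intro allI impI)
    fix k :: nat assume k: "k \<ge> 1"
    have "\<And>R. R \<in> P ` {k..} \<Longrightarrow> band_projection R" using proj[OF k] by auto
    then obtain Q where Q: "is_band_projection_Sup (P ` {k..}) Q"
      "\<And>w. (\<And>R. R \<in> P ` {k..} \<Longrightarrow> R w = 0) \<Longrightarrow> Q w = 0"
      using band_projection_Sup_exists[of "P ` {k..}"] by metis
    show "\<exists>Q. is_band_projection_Sup (P ` {k..}) Q
        \<and> Q e \<le> e - (INF i. complement_prod P k i e)"
      using Q(1) Sup_projection_bound[OF proj[OF k] e Q] by blast
  qed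
  then obtain Q where Q: "\<And>k. k \<ge> 1 \<Longrightarrow> is_band_projection_Sup (P ` {k..}) (Q k)"
    "\<And>k. k \<ge> 1 \<Longrightarrow> Q k e \<le> e - (INF i. complement_prod P k i e)"
    by metis
  have "is_band_projection_Inf (Q ` {1..}) (\<lambda>f. 0)"
    unfolding is_band_projection_Inf_def
  proof (intro conjI ballI allI impI)
    show "band_projection (\<lambda>f::'a. 0)" by (rule band_projectionI) (auto simp: linear_iff)
    fix R assume "R \<in> Q ` {1..}"
    then show "op_le (\<lambda>f. 0) R"
      using Q(1) unfolding op_le_def is_band_projection_Sup_def
      by (metis atLeast_iff band_projection_nonneg imageE)
  next
    fix R assume R: "band_projection R \<and> (\<forall>P\<in>Q ` {1..}. op_le R P)"
    then have Re: "0 \<le> R e" using e by (simp add: band_projection_nonneg)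
    have "T (R e) \<le> 0"
    proof (rule nonpos_of_order_null_bounds[OF assms(6,8) _ assms(7)])
      fix n :: nat assume n: "n \<ge> 1"
      show "0 \<le> T (P (n + m) (complement_prod P n m e))"
        by (rule T(3)[OF band_projection_nonneg[OF assms(5)[OF trans_le_add1[OF n]]
                complement_prod_nonneg[OF proj[OF n] e order_refl]]])
    next
      fix k b assume k: "1 \<le> k"
        and b: "\<And>i. (\<Sum>j\<in>{k..<k + m}. T (P j e))
          + (\<Sum>n\<in>{k..<k + i}. T (P (n + m) (complement_prod P n m e))) \<le> b"
      let ?C = "\<lambda>i. complement_prod P k i e"
      note facts = proj[OF k] e
      have "R e \<le> e - (INF i. ?C i)"
      proof (rule order_trans[OF _ Q(2)[OF k]])
        show "R e \<le> Q k e" using R k e by (simp add: op_le_def)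
      qed
      then have "T (R e) \<le> T (e - (INF i. ?C i))" by (rule Tmono)
      also have "\<dots> \<le> b"
      proof (rule order_continuous_INF_le[OF T(1,2)])
        show "?C j \<le> ?C i" if "i \<le> j" for i j
          using complement_prod_antimono[OF facts, of i "j - i"] that by simp
        show "bdd_below (range ?C)"
          using complement_prod_nonneg[OF facts] by (auto intro: bdd_belowI[of _ 0])
        fix i
        \<comment> \<open>The telescoping estimates speak of lengths from \<open>m\<close> on; longer products are smaller.\<close>
        have "?C (m + i) \<le> ?C i"
          using complement_prod_antimono[OF facts, of i m] by (simp add: add.commute)
        then have "e - ?C i \<le> (e - ?C m) + (?C m - ?C (m + i))" by simp
        also have "\<dots> \<le> (\<Sum>j\<in>{k..<k+m}. P j e)
            + (\<Sum>n\<in>{k..<k+i}. P (n + m) (complement_prod P n m e))"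
          by (intro add_mono complement_prod_initial[OF facts] complement_prod_later[OF facts])
        finally have "T (e - ?C i) \<le> T \<dots>" by (rule Tmono)
        also have "\<dots> \<le> b" using b[of i] T(1) by (simp add: linear_add linear_sum)
        finally show "T (e - ?C i) \<le> b" .
      qed
      finally show "T (R e) \<le> b" .
    qed
    then have "T (R e) = 0" using T(3)[OF Re] by simp
    then have "R e = 0" using assms(2) Re by (auto simp: strictly_positive_def)
    then have "R f = 0" for f by (rule band_projection_eq_0[OF conjunct1[OF R] assms(3)])
    then show "op_le R (\<lambda>f. 0)" by (simp add: op_le_def)
  qed
  then show ?thesis
    unfolding is_band_projection_limsup_def using Q(1) by blast
qed

end
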